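(* For each finite nonempty set $V$ let $\mathrm{MG}[V]$ be the $\mathbb{K}$-vector space with basis the multigraphs on $V$ (and $\mathrm{MG}[\emptyset]=\{0\}$). For disjoint finite sets $V_1,V_2$ with $V_2$ nonempty, $*\notin V_1\sqcup V_2$, and multigraphs $g_1$ on $V_1\sqcup\{*\}$ and $g_2$ on $V_2$, define $g_1\circ_* g_2$ as the sum (with multiplicity) over all multigraphs obtained as follows: take the disjoint union of $g_1$ and $g_2$; remove the vertex $*$ from $g_1$; reconnect each edge end that was attached to $*$ to any vertex of $V_2$, independently for each such end (a loop at $*$ has two such ends). That is, if $m$ is the number of edge ends attached to $*$ in $g_1$, $g_1\circ_*g_2$ is the sum over all $|V_2|^m$ maps from these ends to $V_2$ of the resulting multigraph on $V_1\sqcup V_2$. Extend bilinearly. Then the species $\mathrm{MG}$ endowed with this partial composition (with units the edgeless graph on $\{v\}$) is an operad.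
   Context: $\mathbb{K}$ is a field of characteristic $0$. A (linear) species $S$ is a functor from finite sets with bijections to $\mathbb{K}$-vector spaces, $V\mapsto S[V]$, $\sigma\mapsto S[\sigma]$. An operad is a species $O$ with $O[\emptyset]=\{0\}$, units $e(v)\in O[\{v\}]$ (natural in $v$), and bilinear maps $\circ_*:O[V_1\sqcup\{*\}]\times O[V_2]\to O[V_1\sqcup V_2]$ (partial compositions, for disjoint finite sets $V_1$, $V_2$ and $*\notin V_1\sqcup V_2$), natural with respect to bijections, such that (i) $(x\circ_{*_1}y)\circ_{*_2}z=(x\circ_{*_2}z)\circ_{*_1}y$ for $x\in O[V_1\sqcup\{*_1,*_2\}]$, $y\in O[V_2]$, $z\in O[V_3]$; (ii) $(x\circ_{*_1}y)\circ_{*_2}z=x\circ_{*_1}(y\circ_{*_2}z)$ for $x\in O[V_1\sqcup\{*_1\}]$, $y\in O[V_2\sqcup\{*_2\}]$, $z\in O[V_3]$; (iii) $x\circ_* e(v)=O[\sigma](x)$, where $\sigma$ sends $*$ to $v$ and is the identity elsewhere, and $e( * )\circ_* x=x$. A multigraph on $V$ is a finite multiset of unordered pairs $\{u,v\}$ of (possibly equal) elements of $V$, called edges; the two vertices of an edge are its two ends (a loop has two ends at the same vertex). *)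

theory Defs
  imports Complex_Main "HOL-Library.Uprod" "HOL-Library.Multiset"
    "HOL-Library.FuncSet" "HOL-Library.Poly_Mapping"
begin

section \<open>Linear species\<close>

text \<open>
  The finite sets are the finite subsets of an arbitrary type \<open>'v\<close>, and the vector spaces
  \<open>S V\<close> are subspaces of one ambient vector space.  The subspaces may overlap, so the
  structure maps carry the finite sets involved as arguments: \<open>trans V \<sigma>\<close> is
  \<open>S[\<sigma>]\<close> for a bijection \<open>\<sigma>\<close> defined on \<open>V\<close> (only the values of \<open>\<sigma>\<close> on \<open>V\<close> matter,
  and the target of \<open>\<sigma>\<close> is \<open>\<sigma> ` V\<close>).
\<close>

locale linear_species = vector_space scale
  for scale :: "'k::field_char_0 \<Rightarrow> 'x::ab_group_add \<Rightarrow> 'x" +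
  fixes S :: "'v set \<Rightarrow> 'x set"
    and trans :: "'v set \<Rightarrow> ('v \<Rightarrow> 'v) \<Rightarrow> 'x \<Rightarrow> 'x"
  assumes subspace_S: "finite V \<Longrightarrow> subspace (S V)"
    and trans_closed: "\<lbrakk>finite V; bij_betw \<sigma> V W; x \<in> S V\<rbrakk> \<Longrightarrow> trans V \<sigma> x \<in> S W"
    and trans_add: "\<lbrakk>finite V; inj_on \<sigma> V; x \<in> S V; y \<in> S V\<rbrakk>
      \<Longrightarrow> trans V \<sigma> (x + y) = trans V \<sigma> x + trans V \<sigma> y"
    and trans_scale: "\<lbrakk>finite V; inj_on \<sigma> V; x \<in> S V\<rbrakk>
      \<Longrightarrow> trans V \<sigma> (scale c x) = scale c (trans V \<sigma> x)"
    and trans_cong: "\<lbrakk>finite V; inj_on \<sigma> V; \<And>v. v \<in> V \<Longrightarrow> \<sigma> v = \<tau> v; x \<in> S V\<rbrakk>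
      \<Longrightarrow> trans V \<sigma> x = trans V \<tau> x"
    and trans_id: "\<lbrakk>finite V; x \<in> S V\<rbrakk> \<Longrightarrow> trans V id x = x"
    and trans_comp: "\<lbrakk>finite V; bij_betw \<sigma> V W; bij_betw \<tau> W U; x \<in> S V\<rbrakk>
      \<Longrightarrow> trans V (\<tau> \<circ> \<sigma>) x = trans W \<tau> (trans V \<sigma> x)"

section \<open>Operads\<close>

text \<open>
  \<open>comp V1 V2 s x y\<close> is the partial composition of \<open>x \<in> O[V1 \<squnion> {s}]\<close> and \<open>y \<in> O[V2]\<close> at \<open>s\<close>.
  Each axiom below is stated for exactly those label sets for which both sides are defined.
\<close>

definition composable :: "'v set \<Rightarrow> 'v set \<Rightarrow> 'v \<Rightarrow> bool" where
  "composable V1 V2 s \<longleftrightarrow> finite V1 \<and> finite V2 \<and> V1 \<inter> V2 = {} \<and> s \<notin> V1 \<union> V2"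

locale operad = linear_species scale S trans
  for scale :: "'k::field_char_0 \<Rightarrow> 'x::ab_group_add \<Rightarrow> 'x"
    and S :: "'v set \<Rightarrow> 'x set"
    and trans :: "'v set \<Rightarrow> ('v \<Rightarrow> 'v) \<Rightarrow> 'x \<Rightarrow> 'x" +
  fixes unit :: "'v \<Rightarrow> 'x"
    and comp :: "'v set \<Rightarrow> 'v set \<Rightarrow> 'v \<Rightarrow> 'x \<Rightarrow> 'x \<Rightarrow> 'x"
  assumes S_empty: "S {} = {0}"
    and unit_closed: "unit v \<in> S {v}"
    and unit_natural: "trans {v} \<sigma> (unit v) = unit (\<sigma> v)"
    and comp_closed: "\<lbrakk>composable V1 V2 s; x \<in> S (insert s V1); y \<in> S V2\<rbrakk>
      \<Longrightarrow> comp V1 V2 s x y \<in> S (V1 \<union> V2)"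
    and comp_add_left:
      "\<lbrakk>composable V1 V2 s; x \<in> S (insert s V1); x' \<in> S (insert s V1); y \<in> S V2\<rbrakk>
      \<Longrightarrow> comp V1 V2 s (x + x') y = comp V1 V2 s x y + comp V1 V2 s x' y"
    and comp_add_right:
      "\<lbrakk>composable V1 V2 s; x \<in> S (insert s V1); y \<in> S V2; y' \<in> S V2\<rbrakk>
      \<Longrightarrow> comp V1 V2 s x (y + y') = comp V1 V2 s x y + comp V1 V2 s x y'"
    and comp_scale_left: "\<lbrakk>composable V1 V2 s; x \<in> S (insert s V1); y \<in> S V2\<rbrakk>
      \<Longrightarrow> comp V1 V2 s (scale c x) y = scale c (comp V1 V2 s x y)"
    and comp_scale_right: "\<lbrakk>composable V1 V2 s; x \<in> S (insert s V1); y \<in> S V2\<rbrakk>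
      \<Longrightarrow> comp V1 V2 s x (scale c y) = scale c (comp V1 V2 s x y)"
    and comp_natural:
      "\<lbrakk>composable V1 V2 s; composable W1 W2 t;
        bij_betw \<sigma>1 (insert s V1) (insert t W1); \<sigma>1 s = t; bij_betw \<sigma>2 V2 W2;
        x \<in> S (insert s V1); y \<in> S V2\<rbrakk>
      \<Longrightarrow> trans (V1 \<union> V2) (\<lambda>v. if v \<in> V1 then \<sigma>1 v else \<sigma>2 v) (comp V1 V2 s x y)
          = comp W1 W2 t (trans (insert s V1) \<sigma>1 x) (trans V2 \<sigma>2 y)"
    and comp_parallel:
      "\<lbrakk>finite V1; finite V2; finite V3;
        V1 \<inter> V2 = {}; V1 \<inter> V3 = {}; V2 \<inter> V3 = {};
        s1 \<noteq> s2; s1 \<notin> V1 \<union> V2 \<union> V3; s2 \<notin> V1 \<union> V2 \<union> V3;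
        x \<in> S (V1 \<union> {s1, s2}); y \<in> S V2; z \<in> S V3\<rbrakk>
      \<Longrightarrow> comp (V1 \<union> V2) V3 s2 (comp (insert s2 V1) V2 s1 x y) z
          = comp (V1 \<union> V3) V2 s1 (comp (insert s1 V1) V3 s2 x z) y"
    and comp_sequential:
      "\<lbrakk>finite V1; finite V2; finite V3;
        V1 \<inter> V2 = {}; V1 \<inter> V3 = {}; V2 \<inter> V3 = {};
        s1 \<noteq> s2; s1 \<notin> V1 \<union> V2 \<union> V3; s2 \<notin> V1 \<union> V2 \<union> V3;
        x \<in> S (insert s1 V1); y \<in> S (insert s2 V2); z \<in> S V3\<rbrakk>
      \<Longrightarrow> comp (V1 \<union> V2) V3 s2 (comp V1 (insert s2 V2) s1 x y) z
          = comp V1 (V2 \<union> V3) s1 x (comp V2 V3 s2 y z)"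
    and comp_unit_right: "\<lbrakk>composable V {v} s; x \<in> S (insert s V)\<rbrakk>
      \<Longrightarrow> comp V {v} s x (unit v) = trans (insert s V) (id(s := v)) x"
    and comp_unit_left: "\<lbrakk>composable {} V s; x \<in> S V\<rbrakk>
      \<Longrightarrow> comp {} V s (unit s) x = x"

section \<open>The species of multigraphs\<close>

type_synonym 'v multigraph = "'v uprod multiset"

definition multigraphs :: "'v set \<Rightarrow> 'v multigraph set" where
  "multigraphs V = {g. \<forall>e \<in># g. set_uprod e \<subseteq> V}"

definition mg_scale :: "'k::field_char_0 \<Rightarrow> ('v multigraph \<Rightarrow>\<^sub>0 'k) \<Rightarrow> ('v multigraph \<Rightarrow>\<^sub>0 'k)" where
  "mg_scale c x = Poly_Mapping.map (\<lambda>a. c * a) x"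

definition mg_basis :: "'v multigraph \<Rightarrow> ('v multigraph \<Rightarrow>\<^sub>0 'k::field_char_0)" where
  "mg_basis g = Poly_Mapping.single g 1"

definition mg_extend ::
    "('v multigraph \<Rightarrow> ('v multigraph \<Rightarrow>\<^sub>0 'k)) \<Rightarrow> ('v multigraph \<Rightarrow>\<^sub>0 'k)
      \<Rightarrow> ('v multigraph \<Rightarrow>\<^sub>0 'k::field_char_0)" where
  "mg_extend f x = (\<Sum>g \<in> Poly_Mapping.keys x. mg_scale (Poly_Mapping.lookup x g) (f g))"

definition MG :: "'v set \<Rightarrow> ('v multigraph \<Rightarrow>\<^sub>0 'k::field_char_0) set" where
  "MG V = (if V = {} then {0} else {x. Poly_Mapping.keys x \<subseteq> multigraphs V})"

definition mg_trans ::
    "'v set \<Rightarrow> ('v \<Rightarrow> 'v) \<Rightarrow> ('v multigraph \<Rightarrow>\<^sub>0 'k) \<Rightarrow> ('v multigraph \<Rightarrow>\<^sub>0 'k::field_char_0)" where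
  "mg_trans V \<sigma> = mg_extend (\<lambda>g. mg_basis (image_mset (map_uprod \<sigma>) g))"

definition mg_unit :: "'v \<Rightarrow> ('v multigraph \<Rightarrow>\<^sub>0 'k::field_char_0)" where
  "mg_unit v = mg_basis {#}"

section \<open>Partial composition of multigraphs\<close>

text \<open>
  The copies of an edge \<open>e\<close> of \<open>g\<close> are the pairs \<open>(e, k)\<close> with \<open>k < count g e\<close>.  The ends at
  \<open>s\<close> of such a copy are the triples \<open>(e, k, j)\<close> with \<open>j < num_ends s e\<close>.
\<close>

definition num_ends :: "'v \<Rightarrow> 'v uprod \<Rightarrow> nat" where
  "num_ends s e = (if e = Upair s s then 2 else if s \<in> set_uprod e then 1 else 0)"

definition edge_copies :: "'v multigraph \<Rightarrow> ('v uprod \<times> nat) set" where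
  "edge_copies g = {(e, k). k < count g e}"

definition ends_at :: "'v \<Rightarrow> 'v multigraph \<Rightarrow> ('v uprod \<times> nat \<times> nat) set" where
  "ends_at s g = {(e, k, j). (e, k) \<in> edge_copies g \<and> j < num_ends s e}"

text \<open>In \<open>reconnect_edge\<close>, the \<open>j\<close>-th end at \<open>s\<close> of the edge is moved to \<open>h j\<close>.\<close>

definition reconnect_edge :: "'v \<Rightarrow> (nat \<Rightarrow> 'v) \<Rightarrow> 'v uprod \<Rightarrow> 'v uprod" where
  "reconnect_edge s h e =
    (if e = Upair s s then Upair (h 0) (h 1)
     else map_uprod (\<lambda>v. if v = s then h 0 else v) e)"

definition reconnect ::
    "'v \<Rightarrow> ('v uprod \<times> nat \<times> nat \<Rightarrow> 'v) \<Rightarrow> 'v multigraph \<Rightarrow> 'v multigraph" where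
  "reconnect s f g =
    image_mset (\<lambda>(e, k). reconnect_edge s (\<lambda>j. f (e, k, j)) e) (mset_set (edge_copies g))"

definition mg_comp_basis ::
    "'v set \<Rightarrow> 'v \<Rightarrow> 'v multigraph \<Rightarrow> 'v multigraph \<Rightarrow> ('v multigraph \<Rightarrow>\<^sub>0 'k::field_char_0)" where
  "mg_comp_basis V2 s g1 g2 =
    (\<Sum>f \<in> ends_at s g1 \<rightarrow>\<^sub>E V2. mg_basis (reconnect s f g1 + g2))"

definition mg_comp ::
    "'v set \<Rightarrow> 'v set \<Rightarrow> 'v \<Rightarrow> ('v multigraph \<Rightarrow>\<^sub>0 'k) \<Rightarrow> ('v multigraph \<Rightarrow>\<^sub>0 'k)
      \<Rightarrow> ('v multigraph \<Rightarrow>\<^sub>0 'k::field_char_0)" where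
  "mg_comp V1 V2 s x y = mg_extend (\<lambda>g1. mg_extend (\<lambda>g2. mg_comp_basis V2 s g1 g2) y) x"

end

theory Submission
  imports Defs
begin

text \<open>
  A multigraph is a monomial in its edges, so the vector space of multigraphs is a commutative
  polynomial algebra in which disjoint union of multigraphs becomes the product.  A map \<open>N\<close> from
  vertices to multisets of vertices induces an algebra endomorphism, sending the edge
  \<open>{a, b}\<close> to the sum of the edges \<open>{a', b'}\<close> with \<open>a'\<close> in \<open>N a\<close> and \<open>b'\<close> in \<open>N b\<close>.
  Such endomorphisms compose by substitution.  Relabelling is the case of singletons, and expanding
  the product over the edges shows that the partial composition of \<open>x\<close> and \<open>y\<close> at \<open>s\<close> is the
  image of \<open>x\<close> under the endomorphism replacing \<open>s\<close> by \<open>V2\<close>, multiplied by \<open>y\<close>.  Each operad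
  axiom thereby reduces to an equality of two such maps \<open>N\<close> on the vertices concerned.
\<close>

section \<open>Multigraphs as monomials in a commutative algebra\<close>

text \<open>The edgeless multigraph \<open>0\<close> is the trivial monomial, so scalars embed as
  constant polynomials and the vector space laws become ring laws.\<close>

lemma mg_scale_eq_mult: "mg_scale c x = Poly_Mapping.single 0 c * x"
  by (simp add: mg_scale_def mult_map_scale_conv_mult)

lemma mg_scale_mult: "mg_scale (c * d) (x * y) = mg_scale c x * mg_scale d y"
proof -
  have "Poly_Mapping.single 0 (c * d) =
    (Poly_Mapping.single 0 c * Poly_Mapping.single 0 d :: 'a multigraph \<Rightarrow>\<^sub>0 'b)"
    by (simp add: mult_single)
  then show ?thesis by (simp only: mg_scale_eq_mult ac_simps)
qed

lemma mg_scale_lookup: "Poly_Mapping.lookup (mg_scale c x) g = c * Poly_Mapping.lookup x g"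
  by (simp add: mg_scale_def map.rep_eq when_def)

lemma vector_space_mg_scale: "vector_space mg_scale"
  by unfold_locales
    (simp_all add: mg_scale_eq_mult distrib_left distrib_right single_add mult_single flip: mult.assoc)

lemma mg_scale_times: "mg_scale c x * y = mg_scale c (x * y)"
  and mult_mg_scale: "x * mg_scale c y = mg_scale c (x * y)"
  by (simp_all only: mg_scale_eq_mult ac_simps)

lemma mg_scale_basis: "mg_scale c (mg_basis g) = Poly_Mapping.single g c"
  by (simp add: mg_scale_eq_mult mg_basis_def mult_single)

lemma mg_basis_add: "mg_basis (g + h) = mg_basis g * mg_basis h"
  by (simp add: mg_basis_def mult_single)

lemma mg_basis_empty [simp]: "mg_basis {#} = 1"
  by (simp add: mg_basis_def flip: single_one)

lemma mg_basis_add_mset: "mg_basis (add_mset e g) = mg_basis {#e#} * mg_basis g"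
  using mg_basis_add[of "{#e#}" g] by simp

lemma mg_basis_eq_prod_mset: "mg_basis g = (\<Prod>e\<in>#g. mg_basis {#e#})"
proof (induction g)
  case (add e g)
  then show ?case by (subst mg_basis_add_mset) simp
qed simp

lemma mg_basis_image_mset: "mg_basis (image_mset f A) = (\<Prod>a\<in>#A. mg_basis {#f a#})"
  by (subst mg_basis_eq_prod_mset) (simp add: image_mset.compositionality o_def)

lemma mg_basis_image_mset_mset_set:
  "mg_basis (image_mset f (mset_set A)) = (\<Prod>a\<in>A. mg_basis {#f a#})"
  by (simp add: mg_basis_image_mset prod_unfold_prod_mset)

section \<open>Induction on monomials and linear extension\<close>

lemma poly_mapping_eq_sum_single:
  "(\<Sum>g\<in>Poly_Mapping.keys x. Poly_Mapping.single g (Poly_Mapping.lookup x g)) = x"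
  by (rule poly_mapping_eqI)
    (simp add: lookup_sum lookup_single when_def in_keys_iff)

text \<open>A finitely supported function is the finite sum of its monomials. The set
  \<open>A\<close> keeps track of the support, so that multigraphs on a fixed vertex set can be
  handled one at a time.\<close>

lemma poly_mapping_keys_induct [consumes 1, case_names zero add]:
  fixes x :: "'a \<Rightarrow>\<^sub>0 'b::comm_monoid_add"
  assumes "Poly_Mapping.keys x \<subseteq> A" "P 0"
    and "\<And>c g x. g \<in> A \<Longrightarrow> P x \<Longrightarrow> P (Poly_Mapping.single g c + x)"
  shows "P x"
proof -
  have "P (\<Sum>g\<in>B. Poly_Mapping.single g (Poly_Mapping.lookup x g))"
    if "finite B" "B \<subseteq> A" for B
    using that by (induction B rule: finite_induct) (auto intro: assms)
  from this[OF finite_keys assms(1)] show ?thesis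
    by (simp add: poly_mapping_eq_sum_single)
qed

lemmas poly_mapping_single_induct [case_names zero add] =
  poly_mapping_keys_induct[OF subset_UNIV]

lemma mg_extend_0 [simp]: "mg_extend f 0 = 0"
  by (simp add: mg_extend_def)

text \<open>The added indices carry coefficient zero. A common index set for several arguments makes
  linearity a termwise matter.\<close>

lemma mg_extend_superset:
  assumes "finite A" "Poly_Mapping.keys x \<subseteq> A"
  shows "mg_extend f x = (\<Sum>g\<in>A. mg_scale (Poly_Mapping.lookup x g) (f g))"
  unfolding mg_extend_def
  by (rule sum.mono_neutral_left) (use assms in \<open>auto simp: in_keys_iff mg_scale_eq_mult\<close>)

lemma mg_extend_add: "mg_extend f (x + y) = mg_extend f x + mg_extend f y"
proof -
  let ?A = "Poly_Mapping.keys x \<union> Poly_Mapping.keys y"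
  have "Poly_Mapping.keys (x + y) \<subseteq> ?A" by (rule Poly_Mapping.keys_add)
  then show ?thesis
    by (simp add: mg_extend_superset[of ?A] lookup_add mg_scale_eq_mult single_add
        distrib_right sum.distrib)
qed

lemma keys_mg_scale: "Poly_Mapping.keys (mg_scale c x) \<subseteq> Poly_Mapping.keys x"
  by (auto simp: in_keys_iff mg_scale_lookup)

lemma mg_extend_scale: "mg_extend f (mg_scale c x) = mg_scale c (mg_extend f x)"
  by (simp add: mg_extend_superset[of "Poly_Mapping.keys x"] keys_mg_scale mg_scale_lookup)
    (simp add: mg_scale_eq_mult sum_distrib_left mult_single flip: mult.assoc)

lemma mg_extend_single: "mg_extend f (Poly_Mapping.single g c) = mg_scale c (f g)"
  by (simp add: mg_extend_def mg_scale_eq_mult)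

lemma mg_extend_basis [simp]: "mg_extend f (mg_basis g) = f g"
  by (simp add: mg_basis_def mg_extend_single mg_scale_eq_mult)

text \<open>By linearity in each factor it suffices to compare monomials, where the product is the
  sum of multigraphs.\<close>

lemma mg_extend_mult:
  assumes "\<And>g h. f (g + h) = f g * f h"
  shows "mg_extend f (x * y) = mg_extend f x * mg_extend f y"
proof (induction x rule: poly_mapping_single_induct)
  case (add c g x)
  have "mg_extend f (Poly_Mapping.single g c * y) = mg_scale c (f g) * mg_extend f y"
    by (induction y rule: poly_mapping_single_induct)
      (simp_all add: distrib_left mg_extend_add mult_single mg_extend_single assms mg_scale_mult)
  with add show ?case
    by (simp add: distrib_right mg_extend_add mg_extend_single)
qed simp

section \<open>Vertex substitutions as algebra endomorphisms\<close>

text \<open>The two ends are expanded independently, even for a loop, which matches the two ends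
  that a loop has in the partial composition. Multisets as values keep the multiplicities under
  iteration.\<close>

lift_definition edge_subst ::
    "('v \<Rightarrow> 'v multiset) \<Rightarrow> 'v uprod \<Rightarrow> ('v multigraph \<Rightarrow>\<^sub>0 'k::field_char_0)"
  is "\<lambda>N (a, b). \<Sum>a'\<in>#N a. \<Sum>b'\<in>#N b. mg_basis {#Upair a' b'#}"
proof -
  fix N :: "'v \<Rightarrow> 'v multiset" and p q :: "'v \<times> 'v"
  have swap: "(\<Sum>a'\<in>#N a. \<Sum>b'\<in>#N b. mg_basis {#Upair a' b'#} :: 'v multigraph \<Rightarrow>\<^sub>0 'k) =
    (\<Sum>a'\<in>#N b. \<Sum>b'\<in>#N a. mg_basis {#Upair a' b'#})" for a b
    \<comment> \<open>After the exchange of sums only the order inside each \<open>Upair\<close>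
      differs, and that is immaterial.\<close>
    by (subst sum_mset.swap) (intro arg_cong[where f = sum_mset] image_mset_cong
        arg_cong[where f = "\<lambda>e. mg_basis {#e#}"], simp)
  assume "eq_upair p q"
  then show "(case p of (a, b) \<Rightarrow> \<Sum>a'\<in>#N a. \<Sum>b'\<in>#N b. mg_basis {#Upair a' b'#}) =
    ((case q of (a, b) \<Rightarrow> \<Sum>a'\<in>#N a. \<Sum>b'\<in>#N b. mg_basis {#Upair a' b'#})
      :: 'v multigraph \<Rightarrow>\<^sub>0 'k)"
    by (cases p; cases q) (auto, rule swap)
qed

lemma edge_subst_Upair:
  "edge_subst N (Upair a b) = (\<Sum>a'\<in>#N a. \<Sum>b'\<in>#N b. mg_basis {#Upair a' b'#})"
  by transfer simp

lemma edge_subst_cong: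
  assumes "\<And>v. v \<in> set_uprod e \<Longrightarrow> N v = M v"
  shows "edge_subst N e = edge_subst M e"
  using assms by (cases e) (simp add: edge_subst_Upair)

lemma edge_subst_single: "edge_subst (\<lambda>v. {#\<sigma> v#}) e = mg_basis {#map_uprod \<sigma> e#}"
  by (cases e) (simp add: edge_subst_Upair)

definition vertex_subst ::
    "('v \<Rightarrow> 'v multiset) \<Rightarrow> ('v multigraph \<Rightarrow>\<^sub>0 'k) \<Rightarrow> ('v multigraph \<Rightarrow>\<^sub>0 'k::field_char_0)" where
  "vertex_subst N = mg_extend (\<lambda>g. \<Prod>e\<in>#g. edge_subst N e)"

lemma vertex_subst_0 [simp]: "vertex_subst N 0 = 0"
  and vertex_subst_add: "vertex_subst N (x + y) = vertex_subst N x + vertex_subst N y"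
  and vertex_subst_scale: "vertex_subst N (mg_scale c x) = mg_scale c (vertex_subst N x)"
  and vertex_subst_single:
    "vertex_subst N (Poly_Mapping.single g c) = mg_scale c (\<Prod>e\<in>#g. edge_subst N e)"
  and vertex_subst_basis: "vertex_subst N (mg_basis g) = (\<Prod>e\<in>#g. edge_subst N e)"
  and vertex_subst_mult: "vertex_subst N (x * y) = vertex_subst N x * vertex_subst N y"
  by (simp_all add: vertex_subst_def mg_extend_add mg_extend_scale mg_extend_single mg_extend_mult)

lemma vertex_subst_1 [simp]: "vertex_subst N 1 = 1"
  using vertex_subst_basis[of N "{#}"] by simp

lemma vertex_subst_prod_mset: "vertex_subst N (\<Prod>e\<in>#g. f e) = (\<Prod>e\<in>#g. vertex_subst N (f e))"
  by (induction g) (simp_all add: vertex_subst_mult)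

lemma vertex_subst_sum_mset: "vertex_subst N (\<Sum>e\<in>#A. f e) = (\<Sum>e\<in>#A. vertex_subst N (f e))"
  by (induction A) (simp_all add: vertex_subst_add)

text \<open>Each edge of a multigraph on \<open>V\<close> involves only vertices of
  \<open>V\<close>. This is what turns an operad axiom into a check vertex by vertex.\<close>

lemma vertex_subst_cong:
  assumes "Poly_Mapping.keys x \<subseteq> multigraphs V" "\<And>v. v \<in> V \<Longrightarrow> N v = M v"
  shows "vertex_subst N x = vertex_subst M x"
  using assms(1)
proof (induction x rule: poly_mapping_keys_induct)
  case (add c g x)
  have "(\<Prod>e\<in>#g. edge_subst N e) = (\<Prod>e\<in>#g. edge_subst M e :: 'a multigraph \<Rightarrow>\<^sub>0 'b)"
    by (intro arg_cong[where f = prod_mset] image_mset_cong edge_subst_cong assms(2))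
      (use add in \<open>auto simp: multigraphs_def\<close>)
  with add show ?case by (simp add: vertex_subst_add vertex_subst_single)
qed simp

lemma vertex_subst_id:
  assumes "Poly_Mapping.keys x \<subseteq> multigraphs V" "\<And>v. v \<in> V \<Longrightarrow> N v = {#v#}"
  shows "vertex_subst N x = x"
proof -
  have "map_uprod (\<lambda>v. v) e = e" for e :: "'a uprod" by (cases e) simp
  then have edge: "edge_subst (\<lambda>v. {#v#}) e = (mg_basis {#e#} :: 'a multigraph \<Rightarrow>\<^sub>0 'b)" for e
    using edge_subst_single[of "\<lambda>v. v" e] by simp
  have "vertex_subst (\<lambda>v. {#v#}) x = x"
    by (induction x rule: poly_mapping_single_induct)
      (simp_all only: vertex_subst_0 vertex_subst_add vertex_subst_single edge
        mg_basis_eq_prod_mset[symmetric] mg_scale_basis)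
  with vertex_subst_cong[OF assms] show ?thesis by simp
qed

lemma sum_mset_sum_mset: "(\<Sum>a\<in>#(\<Sum>b\<in>#A. f b). g a) = (\<Sum>b\<in>#A. \<Sum>a\<in>#f b. g a)"
  by (induction A) simp_all

lemma sum_mset_singleton_eq:
  assumes "\<And>a. a \<in># A \<Longrightarrow> f a = {#a#}"
  shows "(\<Sum>a\<in>#A. f a) = A"
proof -
  have "image_mset f A = image_mset (\<lambda>a. {#a#}) A"
    using assms by (rule image_mset_cong)
  then show ?thesis by simp
qed

text \<open>Both sides are linear and multiplicative in \<open>x\<close>, so a single edge decides.
  The composite is Kleisli composition for the multiset monad.\<close>

lemma vertex_subst_vertex_subst:
  "vertex_subst M (vertex_subst N x) = vertex_subst (\<lambda>v. \<Sum>a\<in>#N v. M a) x"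
proof (induction x rule: poly_mapping_single_induct)
  case (add c g x)
  have "vertex_subst M (edge_subst N e) = (edge_subst (\<lambda>v. \<Sum>a\<in>#N v. M a) e :: 'a multigraph \<Rightarrow>\<^sub>0 'b)" for e
  proof (cases e)
    case (Upair a b)
    have "vertex_subst M (edge_subst N e) =
      (\<Sum>a'\<in>#N a. \<Sum>b'\<in>#N b. \<Sum>a''\<in>#M a'. \<Sum>b''\<in>#M b'. (mg_basis {#Upair a'' b''#} :: 'a multigraph \<Rightarrow>\<^sub>0 'b))"
      by (simp add: Upair edge_subst_Upair vertex_subst_sum_mset vertex_subst_basis)
    also have "\<dots> =
      (\<Sum>a'\<in>#N a. \<Sum>a''\<in>#M a'. \<Sum>b'\<in>#N b. \<Sum>b''\<in>#M b'. mg_basis {#Upair a'' b''#})"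
      \<comment> \<open>The sums over \<open>b'\<close> and \<open>a''\<close> are exchanged;
        neither range depends on the other variable.\<close>
      by (subst (2) sum_mset.swap) (rule refl)
    finally show ?thesis by (simp add: Upair edge_subst_Upair sum_mset_sum_mset)
  qed
  with add show ?case
    by (simp add: vertex_subst_add vertex_subst_single vertex_subst_scale vertex_subst_prod_mset)
qed simp

section \<open>Vertex sets of the multigraphs that occur\<close>

lemma multigraphs_empty: "{#} \<in> multigraphs V"
  by (simp add: multigraphs_def)

lemma multigraphs_add: "g \<in> multigraphs V \<Longrightarrow> h \<in> multigraphs V \<Longrightarrow> g + h \<in> multigraphs V"
  by (auto simp: multigraphs_def)

lemma multigraphs_mono: "V \<subseteq> W \<Longrightarrow> multigraphs V \<subseteq> multigraphs W"
  by (auto simp: multigraphs_def)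

lemma keys_mg_mult:
  assumes "Poly_Mapping.keys x \<subseteq> multigraphs V" "Poly_Mapping.keys y \<subseteq> multigraphs V"
  shows "Poly_Mapping.keys (x * y) \<subseteq> multigraphs V"
  using keys_mult[of x y] assms by (auto intro: multigraphs_add dest!: subsetD)

lemma keys_mg_sum_mset:
  assumes "\<And>a. a \<in># A \<Longrightarrow> Poly_Mapping.keys (f a) \<subseteq> G"
  shows "Poly_Mapping.keys (\<Sum>a\<in>#A. f a) \<subseteq> G"
  using assms by (induction A) (auto dest!: subsetD[OF Poly_Mapping.keys_add])

lemma keys_mg_prod_mset:
  assumes "\<And>a. a \<in># A \<Longrightarrow> Poly_Mapping.keys (f a) \<subseteq> multigraphs V"
  shows "Poly_Mapping.keys (\<Prod>a\<in>#A. f a) \<subseteq> multigraphs V"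
  using assms by (induction A) (simp_all add: keys_mg_mult multigraphs_empty)

text \<open>The new ends of every edge lie in \<open>W\<close>, and products of monomials on
  \<open>W\<close> stay on \<open>W\<close>. Closure under relabelling and under partial composition
  rests on this.\<close>

lemma keys_vertex_subst:
  assumes "Poly_Mapping.keys x \<subseteq> multigraphs V" "\<And>v. v \<in> V \<Longrightarrow> set_mset (N v) \<subseteq> W"
  shows "Poly_Mapping.keys (vertex_subst N x) \<subseteq> multigraphs W"
  using assms(1)
proof (induction x rule: poly_mapping_keys_induct)
  case (add c g x)
  have "Poly_Mapping.keys (edge_subst N e :: 'a multigraph \<Rightarrow>\<^sub>0 'b) \<subseteq> multigraphs W" if "e \<in># g" for e
  proof (cases e)
    case (Upair a b)
    then have "a \<in> V" "b \<in> V" using add that by (auto simp: multigraphs_def)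
    with assms(2) show ?thesis unfolding Upair edge_subst_Upair
      by (intro keys_mg_sum_mset) (auto simp: mg_basis_def multigraphs_def)
  qed
  then have "Poly_Mapping.keys (\<Prod>e\<in>#g. edge_subst N e :: 'a multigraph \<Rightarrow>\<^sub>0 'b) \<subseteq> multigraphs W"
    by (rule keys_mg_prod_mset)
  with add show ?case
    by (auto simp: vertex_subst_add vertex_subst_single
        dest!: subsetD[OF Poly_Mapping.keys_add] subsetD[OF keys_mg_scale])
qed simp

section \<open>Relabelling and partial composition as substitutions\<close>

lemma mg_trans_eq: "mg_trans V \<sigma> = vertex_subst (\<lambda>v. {#\<sigma> v#})"
  by (simp add: mg_trans_def vertex_subst_def edge_subst_single mg_basis_image_mset)

lemma edge_copies_eq_Sigma: "edge_copies g = (SIGMA e:set_mset g. {..<count g e})"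
  by (auto simp: edge_copies_def) (metis count_inI not_less0)

lemma finite_edge_copies [simp]: "finite (edge_copies g)"
  by (simp add: edge_copies_eq_Sigma)

text \<open>An edge \<open>e\<close> contributes \<open>count g e\<close> equal factors. Indexing by
  a set of copies prepares for distributing a product of sums over choice functions.\<close>

lemma prod_edge_copies: "(\<Prod>(e, k)\<in>edge_copies g. f e) = (\<Prod>e\<in>#g. f e)"
  by (simp add: edge_copies_eq_Sigma image_prod_mset_multiplicity flip: prod.Sigma)

text \<open>An edge has zero, one or two ends at \<open>s\<close>, so the functions \<open>h\<close>
  amount to the empty function, an element of \<open>W\<close> or a pair of elements of
  \<open>W\<close>.\<close>

lemma edge_subst_eq_sum_reconnect_edge:
  assumes "finite W"
  shows "edge_subst (\<lambda>v. if v = s then mset_set W else {#v#}) e =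
    (\<Sum>h\<in>{..<num_ends s e} \<rightarrow>\<^sub>E W. mg_basis {#reconnect_edge s h e#})"
proof -
  have single: "(\<Sum>h\<in>{..<1::nat} \<rightarrow>\<^sub>E W. F (h 0)) = (\<Sum>w\<in>W. F w)" for F :: "'a \<Rightarrow> 'a multigraph \<Rightarrow>\<^sub>0 'b"
    by (rule sum.reindex_bij_witness[of _ "\<lambda>w. \<lambda>j\<in>{..<1}. w" "\<lambda>h. h 0"])
      (auto simp: PiE_iff extensional_def)
  have double: "(\<Sum>h\<in>{..<2::nat} \<rightarrow>\<^sub>E W. F (h 0) (h 1)) = (\<Sum>w\<in>W. \<Sum>w'\<in>W. F w w')"
    for F :: "'a \<Rightarrow> 'a \<Rightarrow> 'a multigraph \<Rightarrow>\<^sub>0 'b"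
    unfolding sum.cartesian_product
    by (rule sum.reindex_bij_witness[of _ "\<lambda>(w, w'). \<lambda>j\<in>{..<2}. if j = 0 then w else w'" "\<lambda>h. (h 0, h 1)"])
      (auto simp: PiE_iff extensional_def less_2_cases_iff)
  obtain a b where e: "e = Upair a b" by (cases e)
  consider "a = s" "b = s" | "a = s" "b \<noteq> s" | "a \<noteq> s" "b = s" | "a \<noteq> s" "b \<noteq> s" by blast
  then show ?thesis
  proof cases
    case 1
    then show ?thesis
      by (simp add: e num_ends_def reconnect_edge_def edge_subst_Upair
          double[of "\<lambda>w w'. mg_basis {#Upair w w'#}", simplified] flip: sum_unfold_sum_mset)
  next
    case 2
    then show ?thesis
      by (simp add: e num_ends_def reconnect_edge_def edge_subst_Upair
          single[of "\<lambda>w. mg_basis {#Upair w b#}", simplified] flip: sum_unfold_sum_mset)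
  next
    case 3
    then show ?thesis
      by (simp add: e num_ends_def reconnect_edge_def edge_subst_Upair
          single[of "\<lambda>w. mg_basis {#Upair a w#}", simplified] flip: sum_unfold_sum_mset)
  next
    \<comment> \<open>The domain \<open>{..<0}\<close> is empty, so the sum has exactly one term,
      the unchanged edge.\<close>
    case 4
    then show ?thesis
      by (simp add: e num_ends_def reconnect_edge_def edge_subst_Upair)
  qed
qed

text \<open>Distributivity: expanding the product over edge copies chooses a reconnection for each
  copy, and such a family of choices is a single map from all ends at \<open>s\<close> to
  \<open>W\<close>.\<close>

lemma mg_comp_basis_eq:
  assumes "finite W"
  shows "mg_comp_basis W s g1 g2 =
    vertex_subst (\<lambda>v. if v = s then mset_set W else {#v#}) (mg_basis g1) * mg_basis g2"
proof -
  let ?C = "edge_copies g1"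
  let ?B = "\<lambda>(e, k). {..<num_ends s e} \<rightarrow>\<^sub>E W"
  let ?F = "\<lambda>(e, k) h. mg_basis {#reconnect_edge s h e#} :: 'a multigraph \<Rightarrow>\<^sub>0 'b"
  have "vertex_subst (\<lambda>v. if v = s then mset_set W else {#v#}) (mg_basis g1) =
    (\<Prod>c\<in>?C. \<Sum>h\<in>?B c. ?F c h)"
    by (simp add: vertex_subst_basis edge_subst_eq_sum_reconnect_edge[OF assms]
        case_prod_unfold flip: prod_edge_copies)
  also have "\<dots> = (\<Sum>f\<in>PiE ?C ?B. \<Prod>c\<in>?C. ?F c (f c))"
    by (rule prod_sum_PiE) (auto intro: finite_PiE assms)
  also have "\<dots> = (\<Sum>f\<in>ends_at s g1 \<rightarrow>\<^sub>E W. \<Prod>(e, k)\<in>?C. ?F (e, k) (\<lambda>j. f (e, k, j)))"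
  \<comment> \<open>The bijection is currying. For \<open>j\<close> beyond the ends of
    \<open>e\<close> at \<open>s\<close>, the triple \<open>(e, k, j)\<close> lies outside
    \<open>ends_at s g1\<close>, where \<open>f\<close> is \<open>undefined\<close>; hence the
    curried function is extensional in \<open>j\<close> as well.\<close>
  proof (rule sum.reindex_bij_witness[of _
        "\<lambda>f. \<lambda>(e, k)\<in>?C. \<lambda>j. f (e, k, j)" "\<lambda>f. \<lambda>(e, k, j)\<in>ends_at s g1. f (e, k) j"], goal_cases)
    case (1 f)
    then show ?case
      by (force simp: ends_at_def PiE_iff extensional_def restrict_def fun_eq_iff)
  next
    case (2 f)
    then show ?case
      by (force simp: ends_at_def PiE_iff)
  next
    case (3 f)
    then show ?case
      by (force simp: ends_at_def PiE_iff extensional_def restrict_def fun_eq_iff)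
  next
    case (4 f)
    then show ?case
      by (force simp: ends_at_def PiE_iff extensional_def)
  next
    case (5 f)
    have "(\<lambda>j. (\<lambda>(e, k, j)\<in>ends_at s g1. f (e, k) j) (e, k, j)) = f (e, k)" if "(e, k) \<in> ?C" for e k
      using 5 that by (force simp: ends_at_def PiE_iff extensional_def restrict_def fun_eq_iff)
    then show ?case by (intro prod.cong) auto
  qed
  also have "\<dots> = (\<Sum>f\<in>ends_at s g1 \<rightarrow>\<^sub>E W. mg_basis (reconnect s f g1))"
    by (simp add: reconnect_def mg_basis_image_mset_mset_set case_prod_unfold)
  finally show ?thesis
    by (simp add: mg_comp_basis_def mg_basis_add sum_distrib_right)
qed

text \<open>Both sides are bilinear, so the formula on basis multigraphs extends by induction on
  monomials, first in \<open>y\<close> and then in \<open>x\<close>. All axioms about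
  \<open>mg_comp\<close> are verified through this product.\<close>

lemma mg_comp_eq:
  assumes "finite W"
  shows "mg_comp V W s x y = vertex_subst (\<lambda>v. if v = s then mset_set W else {#v#}) x * y"
proof -
  let ?N = "\<lambda>v. if v = s then mset_set W else {#v#}"
  have *: "mg_extend (\<lambda>g2. mg_comp_basis W s g1 g2) y = vertex_subst ?N (mg_basis g1) * y" for g1
    by (induction y rule: poly_mapping_single_induct)
      (simp_all add: mg_extend_add mg_extend_scale mg_comp_basis_eq[OF assms] distrib_left
        mult_mg_scale flip: mg_scale_basis)
  show ?thesis unfolding mg_comp_def *
    by (induction x rule: poly_mapping_single_induct)
      (simp_all add: mg_extend_add mg_extend_single vertex_subst_add vertex_subst_single
        vertex_subst_basis distrib_right mg_scale_times)
qed

section \<open>The species and operad axioms\<close>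

lemma MG_keys: "x \<in> MG V \<Longrightarrow> Poly_Mapping.keys x \<subseteq> multigraphs V"
  by (auto simp: MG_def split: if_splits)

lemma linear_species_MG: 
  "linear_species (mg_scale :: 'k::field_char_0 \<Rightarrow> ('v multigraph \<Rightarrow>\<^sub>0 'k) \<Rightarrow> ('v multigraph \<Rightarrow>\<^sub>0 'k))
    MG mg_trans"
proof -
  interpret vector_space "mg_scale :: 'k \<Rightarrow> ('v multigraph \<Rightarrow>\<^sub>0 'k) \<Rightarrow> ('v multigraph \<Rightarrow>\<^sub>0 'k)"
    by (rule vector_space_mg_scale)
  show ?thesis
  proof
    fix V :: "'v set"
    show "subspace (MG V)"
      by (rule subspaceI)
        (auto simp: MG_def mg_scale_eq_mult split: if_splits
          dest!: subsetD[OF Poly_Mapping.keys_add] subsetD[OF keys_mg_scale[unfolded mg_scale_eq_mult]])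
  next
    fix V W and \<sigma> :: "'v \<Rightarrow> 'v" and x :: "'v multigraph \<Rightarrow>\<^sub>0 'k"
    assume "bij_betw \<sigma> V W" "x \<in> MG V"
    then show "mg_trans V \<sigma> x \<in> MG W"
      using keys_vertex_subst[OF MG_keys, of x V "\<lambda>v. {#\<sigma> v#}" W]
      \<comment> \<open>\<open>MG {}\<close> is zero, not the span of the edgeless graph, so the
        empty set is separate: there \<open>x\<close> is 0 and \<open>W\<close> is empty
        too.\<close>
      by (cases "V = {}") (auto simp: MG_def mg_trans_eq bij_betw_def)
  next
    fix V W U and \<sigma> \<tau> :: "'v \<Rightarrow> 'v" and x :: "'v multigraph \<Rightarrow>\<^sub>0 'k"
    show "mg_trans V (\<tau> \<circ> \<sigma>) x = mg_trans W \<tau> (mg_trans V \<sigma> x)"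
      by (simp add: mg_trans_eq vertex_subst_vertex_subst)
  next
    fix V and x :: "'v multigraph \<Rightarrow>\<^sub>0 'k" assume "x \<in> MG V"
    then show "mg_trans V id x = x"
      unfolding mg_trans_eq by (rule vertex_subst_id[OF MG_keys]) simp
  next
    fix V and \<sigma> \<tau> :: "'v \<Rightarrow> 'v" and x :: "'v multigraph \<Rightarrow>\<^sub>0 'k"
    assume "\<And>v. v \<in> V \<Longrightarrow> \<sigma> v = \<tau> v" "x \<in> MG V"
    then show "mg_trans V \<sigma> x = mg_trans V \<tau> x"
      unfolding mg_trans_eq by (intro vertex_subst_cong[OF MG_keys]) auto
  qed (simp_all add: mg_trans_eq vertex_subst_add vertex_subst_scale)
qed

theorem theorem2p2:
  shows "operad (mg_scale :: 'k::field_char_0 \<Rightarrow> ('v multigraph \<Rightarrow>\<^sub>0 'k) \<Rightarrow> ('v multigraph \<Rightarrow>\<^sub>0 'k))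
    MG mg_trans mg_unit mg_comp"
proof -
  interpret linear_species "mg_scale :: 'k \<Rightarrow> ('v multigraph \<Rightarrow>\<^sub>0 'k) \<Rightarrow> ('v multigraph \<Rightarrow>\<^sub>0 'k)" MG mg_trans
    by (rule linear_species_MG)
  show ?thesis
  proof
    show "MG {} = {0}" by (simp add: MG_def)
  next
    fix v show "mg_unit v \<in> MG {v}" by (simp add: MG_def mg_unit_def multigraphs_empty)
  next
    fix v \<sigma> show "mg_trans {v} \<sigma> (mg_unit v) = mg_unit (\<sigma> v)"
      by (simp add: mg_trans_eq mg_unit_def)
  next
    fix V1 V2 :: "'v set" and s and x y :: "'v multigraph \<Rightarrow>\<^sub>0 'k"
    assume c: "composable V1 V2 s" and x: "x \<in> MG (insert s V1)" and y: "y \<in> MG V2"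
    let ?N = "\<lambda>v. if v = s then mset_set V2 else {#v#}"
    have "Poly_Mapping.keys (vertex_subst ?N x) \<subseteq> multigraphs (V1 \<union> V2)"
      using c by (intro keys_vertex_subst[OF MG_keys[OF x]]) (auto simp: composable_def)
    moreover have "Poly_Mapping.keys y \<subseteq> multigraphs (V1 \<union> V2)"
      using MG_keys[OF y] multigraphs_mono[of V2 "V1 \<union> V2"] by blast
    ultimately have "Poly_Mapping.keys (vertex_subst ?N x * y) \<subseteq> multigraphs (V1 \<union> V2)"
      by (rule keys_mg_mult)
    \<comment> \<open>If \<open>V1\<close> and \<open>V2\<close> are both empty, the target is
      \<open>{0}\<close>; then \<open>y\<close> is 0 and the product vanishes.\<close>
    then show "mg_comp V1 V2 s x y \<in> MG (V1 \<union> V2)"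
      using c y by (auto simp: mg_comp_eq composable_def MG_def)
  next
    fix V1 V2 W1 W2 :: "'v set" and s t \<sigma>1 \<sigma>2 and x y :: "'v multigraph \<Rightarrow>\<^sub>0 'k"
    assume c: "composable V1 V2 s" "composable W1 W2 t"
      and \<sigma>: "bij_betw \<sigma>1 (insert s V1) (insert t W1)" "\<sigma>1 s = t" "bij_betw \<sigma>2 V2 W2"
      and x: "x \<in> MG (insert s V1)" and y: "y \<in> MG V2"
    let ?\<sigma> = "\<lambda>v. if v \<in> V1 then \<sigma>1 v else \<sigma>2 v"
    have fin: "finite V2" "finite W2" and disj: "s \<notin> V1" "V1 \<inter> V2 = {}"
      using c by (auto simp: composable_def)
    have image: "image_mset ?\<sigma> (mset_set V2) = mset_set W2"
    proof -
      have "image_mset ?\<sigma> (mset_set V2) = image_mset \<sigma>2 (mset_set V2)"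
        using disj fin by (intro image_mset_cong) auto
      with \<sigma>(3) show ?thesis by (simp add: image_mset_mset_set bij_betw_def)
    qed
    \<comment> \<open>By injectivity of \<open>\<sigma>1\<close>, no vertex other than
      \<open>s\<close> reaches \<open>t\<close>; otherwise the expansion at \<open>t\<close> would
      also replace the image of a vertex of \<open>V1\<close>.\<close>
    have neq: "\<sigma>1 v \<noteq> t" if "v \<in> V1" for v
      using \<sigma>(1,2) disj that by (auto simp: bij_betw_def inj_on_def)
    have "vertex_subst (\<lambda>v. {#?\<sigma> v#}) y = vertex_subst (\<lambda>v. {#\<sigma>2 v#}) y"
      by (rule vertex_subst_cong[OF MG_keys[OF y]]) (use disj in auto)
    moreover have "vertex_subst (\<lambda>v. {#?\<sigma> v#}) (vertex_subst (\<lambda>v. if v = s then mset_set V2 else {#v#}) x) =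
      vertex_subst (\<lambda>v. if v = t then mset_set W2 else {#v#}) (vertex_subst (\<lambda>v. {#\<sigma>1 v#}) x)"
      unfolding vertex_subst_vertex_subst
      by (rule vertex_subst_cong[OF MG_keys[OF x]]) (use \<sigma>(2) disj neq image in auto)
    ultimately show "mg_trans (V1 \<union> V2) ?\<sigma> (mg_comp V1 V2 s x y) =
        mg_comp W1 W2 t (mg_trans (insert s V1) \<sigma>1 x) (mg_trans V2 \<sigma>2 y)"
      by (simp add: mg_comp_eq fin mg_trans_eq vertex_subst_mult)
  next
    fix V1 V2 V3 :: "'v set" and s1 s2 and x y z :: "'v multigraph \<Rightarrow>\<^sub>0 'k"
    assume fin: "finite V1" "finite V2" "finite V3"
      and disj: "V1 \<inter> V2 = {}" "V1 \<inter> V3 = {}" "V2 \<inter> V3 = {}"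
      and s: "s1 \<noteq> s2" "s1 \<notin> V1 \<union> V2 \<union> V3" "s2 \<notin> V1 \<union> V2 \<union> V3"
      and x: "x \<in> MG (V1 \<union> {s1, s2})" and y: "y \<in> MG V2" and z: "z \<in> MG V3"
    let ?N1 = "\<lambda>v. if v = s1 then mset_set V2 else {#v#}"
    let ?N2 = "\<lambda>v. if v = s2 then mset_set V3 else {#v#}"
    \<comment> \<open>Neither expansion touches the vertices created by the other. In both orders
      \<open>s1\<close> becomes \<open>V2\<close>, \<open>s2\<close> becomes \<open>V3\<close> and
      \<open>V1\<close> is fixed.\<close>
    have "(\<Sum>a\<in>#mset_set V2. ?N2 a) = mset_set V2" "(\<Sum>a\<in>#mset_set V3. ?N1 a) = mset_set V3"
      by (rule sum_mset_singleton_eq; use s fin in auto)+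
    then have "vertex_subst ?N2 (vertex_subst ?N1 x) = vertex_subst ?N1 (vertex_subst ?N2 x)"
      unfolding vertex_subst_vertex_subst
      by (intro vertex_subst_cong[OF MG_keys[OF x]]) (use s in auto)
    moreover have "vertex_subst ?N2 y = y"
      by (rule vertex_subst_id[OF MG_keys[OF y]]) (use s in auto)
    moreover have "vertex_subst ?N1 z = z"
      by (rule vertex_subst_id[OF MG_keys[OF z]]) (use s in auto)
    ultimately show "mg_comp (V1 \<union> V2) V3 s2 (mg_comp (insert s2 V1) V2 s1 x y) z =
        mg_comp (V1 \<union> V3) V2 s1 (mg_comp (insert s1 V1) V3 s2 x z) y"
      by (simp add: mg_comp_eq fin vertex_subst_mult ac_simps)
  next
    fix V1 V2 V3 :: "'v set" and s1 s2 and x y z :: "'v multigraph \<Rightarrow>\<^sub>0 'k"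
    assume fin: "finite V1" "finite V2" "finite V3"
      and disj: "V1 \<inter> V2 = {}" "V1 \<inter> V3 = {}" "V2 \<inter> V3 = {}"
      and s: "s1 \<noteq> s2" "s1 \<notin> V1 \<union> V2 \<union> V3" "s2 \<notin> V1 \<union> V2 \<union> V3"
      and x: "x \<in> MG (insert s1 V1)" and y: "y \<in> MG (insert s2 V2)" and z: "z \<in> MG V3"
    let ?N1 = "\<lambda>v. if v = s1 then mset_set (insert s2 V2) else {#v#}"
    let ?N2 = "\<lambda>v. if v = s2 then mset_set V3 else {#v#}"
    \<comment> \<open>Expanding \<open>s1\<close> to \<open>insert s2 V2\<close> and then
      \<open>s2\<close> to \<open>V3\<close> replaces \<open>s1\<close> by \<open>V2\<close>
      together with \<open>V3\<close>. Disjointness makes this multiset sum the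
      \<open>mset_set\<close> of the union.\<close>
    have "(\<Sum>a\<in>#mset_set V2. ?N2 a) = mset_set V2"
      by (rule sum_mset_singleton_eq) (use s fin in auto)
    then have "vertex_subst ?N2 (vertex_subst ?N1 x) =
      vertex_subst (\<lambda>v. if v = s1 then mset_set (V2 \<union> V3) else {#v#}) x"
      unfolding vertex_subst_vertex_subst
      by (intro vertex_subst_cong[OF MG_keys[OF x]])
        (use s fin disj in \<open>auto simp: mset_set_Union\<close>)
    then show "mg_comp (V1 \<union> V2) V3 s2 (mg_comp V1 (insert s2 V2) s1 x y) z =
        mg_comp V1 (V2 \<union> V3) s1 x (mg_comp V2 V3 s2 y z)"
      by (simp add: mg_comp_eq fin vertex_subst_mult mult.assoc)
  next
    fix V v s and x :: "'v multigraph \<Rightarrow>\<^sub>0 'k"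
    assume "x \<in> MG (insert s V)"
    \<comment> \<open>Expansion into a one-element set is a relabelling, and the unit is the ring
      element 1.\<close>
    then have "vertex_subst (\<lambda>u. if u = s then mset_set {v} else {#u#}) x =
      vertex_subst (\<lambda>u. {#(id(s := v)) u#}) x"
      by (intro vertex_subst_cong[OF MG_keys]) auto
    then show "mg_comp V {v} s x (mg_unit v) = mg_trans (insert s V) (id(s := v)) x"
      by (simp add: mg_comp_eq mg_trans_eq mg_unit_def)
  next
    fix V :: "'v set" and s and x :: "'v multigraph \<Rightarrow>\<^sub>0 'k"
    assume "composable {} V s"
    then show "mg_comp {} V s (mg_unit s) x = x"
      by (simp add: mg_comp_eq mg_unit_def composable_def)
  \<comment> \<open>The remaining goals are the bilinearity of partial composition, immediate from
    the product formula.\<close>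
  qed (auto simp: mg_comp_eq composable_def vertex_subst_add vertex_subst_scale distrib_left
      distrib_right mg_scale_times mult_mg_scale)
qed

end
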